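(* Let $d\geq 1$, $V=\mathbb{Z}_3^d$, $r=\frac{3^d-1}{2}$, and let $H_1,\dots,H_r$ be the $r$ linear hyperplanes (codimension-one subspaces) of $V$, labelled arbitrarily. For each $i\in\{1,\dots,r\}$ let $\pi_i:V\to\mathbb{Z}_3$ be a linear epimorphism with $\ker\pi_i=H_i$. Put $\Omega=V\times\{0,1,\dots,r\}$ and write $v_i=(v,i)$. Let $\diamond$ be a binary operation on $[0,r]=\{0,1,\dots,r\}$ such that $a\diamond a=0$ for all $a$ and, for each $a$, the map $x\mapsto a\diamond x$ is a bijection of $[0,r]$ (so $i\diamond j\in\{1,\dots,r\}$ whenever $i\neq j$). For each $0\le i<j\le r$ let $\sigma_{ij}$ be a permutation of $\mathbb{Z}_3$, and put $\sigma_{ji}=\sigma_{ij}^{-1}$. For an array $\Sigma=(\sigma_{ij})_{0\le i<j\le r}$ define $R(\diamond,\Sigma)=\{(u_i,v_j)\in\Omega^2: i\neq j,\ \sigma_{ij}(\pi_{i\diamond j}(u))=\pi_{j\diamond i}(v)\}$. Let $S=\{(u_i,v_j):i=j,\ u\neq v\}$. For each $0\le i<j\le r$ choose a $3$-cycle $\theta_{ij}\in\{(0\,1\,2),(0\,2\,1)\}$ of $\mathbb{Z}_3$, and let $\Theta\Sigma=(\theta_{ij}\sigma_{ij})_{i<j}$, $\Theta^2\Sigma=(\theta_{ij}^2\sigma_{ij})_{i<j}$ (products of permutations; for $i>j$ the entries are again defined as inverses of the $(j,i)$ entries). Put $R_1=R(\diamond,\Sigma)$, $R_2=R(\diamond,\Theta\Sigma)$,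 $R_3=R(\diamond,\Theta^2\Sigma)$. Then $\{1_\Omega,S,R_1,R_2,R_3\}$ is a Jordan scheme on $\Omega$.
   Context: $1_\Omega=\{(\omega,\omega):\omega\in\Omega\}$. For $R\subseteq\Omega^2$: $R(\alpha)=\{\beta:(\alpha,\beta)\in R\}$, $R^\top=\{(\beta,\alpha):(\alpha,\beta)\in R\}$. A rainbow on $\Omega$ is a partition $\mathcal{C}$ of $\Omega^2$ such that $1_\Omega$ is a union of classes and $C^\top\in\mathcal{C}$ for all $C\in\mathcal{C}$. A Jordan configuration is a rainbow such that for all $C,D\in\mathcal{C}$ and all pairs $(\alpha,\beta),(\alpha',\beta')$ in the same class, $|C(\alpha)\cap D^\top(\beta)|+|D(\alpha)\cap C^\top(\beta)|=|C(\alpha')\cap D^\top(\beta')|+|D(\alpha')\cap C^\top(\beta')|$. A Jordan scheme is a Jordan configuration with $1_\Omega\in\mathcal{C}$. *)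

theory Defs
  imports "HOL-Analysis.Analysis" "HOL-Combinatorics.Combinatorics"
begin

text \<open>
  The library type \<open>3\<close> (that is, \<open>num1 bit1\<close>) is the ring of integers modulo 3. The following instance
  makes it a field, so that the library's linear algebra over \<open>3 ^ 'd\<close> (\<open>vec.subspace\<close>, \<open>vec.dim\<close>,
  \<open>Vector_Spaces.linear\<close>) is available. Every nonzero element is its own inverse.
\<close>

instantiation bit1 :: (CARD_1) field
begin

definition inverse_bit1 :: "'a bit1 \<Rightarrow> 'a bit1" where
  "inverse_bit1 x = x"

definition divide_bit1 :: "'a bit1 \<Rightarrow> 'a bit1 \<Rightarrow> 'a bit1" where
  "divide_bit1 x y = x * y"

instance
proof
  fix a b :: "'a bit1"
  show "inverse (0::'a bit1) = 0" by (simp add: inverse_bit1_def)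
  show "a div b = a * inverse b" by (simp add: inverse_bit1_def divide_bit1_def)
  assume "a \<noteq> 0"
  have card: "CARD('a) = 1" by (rule CARD_1)
  have "Rep_bit1 a \<in> {0..<3}" using Rep_bit1[of a] card by simp
  moreover have "Rep_bit1 a \<noteq> 0"
    using \<open>a \<noteq> 0\<close> by (metis Rep_bit1_inverse zero_bit1_def)
  ultimately have "Rep_bit1 a = 1 \<or> Rep_bit1 a = 2" by auto
  then have "Abs_bit1' (Rep_bit1 a * Rep_bit1 a) = (1 :: 'a bit1)"
    using card by (auto simp: Abs_bit1'_def one_bit1_def)
  then show "inverse a * a = 1"
    by (simp add: inverse_bit1_def times_bit1_def)
qed

end

definition rainbow :: "'a set \<Rightarrow> ('a \<times> 'a) set set \<Rightarrow> bool" where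
  "rainbow \<Omega> \<C> \<longleftrightarrow> finite \<Omega> \<and> partition_on (\<Omega> \<times> \<Omega>) \<C> \<and>
     (\<exists>\<B>\<subseteq>\<C>. Id_on \<Omega> = \<Union>\<B>) \<and> (\<forall>C\<in>\<C>. C\<inverse> \<in> \<C>)"

definition jordan_count :: "('a \<times> 'a) set \<Rightarrow> ('a \<times> 'a) set \<Rightarrow> 'a \<Rightarrow> 'a \<Rightarrow> nat" where
  "jordan_count C D \<alpha> \<beta> = card (C `` {\<alpha>} \<inter> D\<inverse> `` {\<beta>}) + card (D `` {\<alpha>} \<inter> C\<inverse> `` {\<beta>})"

definition jordan_configuration :: "'a set \<Rightarrow> ('a \<times> 'a) set set \<Rightarrow> bool" where
  "jordan_configuration \<Omega> \<C> \<longleftrightarrow> rainbow \<Omega> \<C> \<and>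
     (\<forall>C\<in>\<C>. \<forall>D\<in>\<C>. \<forall>E\<in>\<C>. \<forall>\<alpha> \<beta> \<alpha>' \<beta>'. (\<alpha>, \<beta>) \<in> E \<longrightarrow> (\<alpha>', \<beta>') \<in> E \<longrightarrow>
        jordan_count C D \<alpha> \<beta> = jordan_count C D \<alpha>' \<beta>')"

definition jordan_scheme :: "'a set \<Rightarrow> ('a \<times> 'a) set set \<Rightarrow> bool" where
  "jordan_scheme \<Omega> \<C> \<longleftrightarrow> jordan_configuration \<Omega> \<C> \<and> Id_on \<Omega> \<in> \<C>"

definition hyperplanes :: "(3 ^ 'd) set set" where
  "hyperplanes = {H. vec.subspace H \<and> vec.dim H + 1 = CARD('d)}"

text \<open>
  An array \<open>\<Sigma>\<close> is a function of two indices of which only the values at \<open>i < j\<close> are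
  used; \<open>arr_entry\<close> supplies the entries below the diagonal.
\<close>

definition arr_entry :: "(nat \<Rightarrow> nat \<Rightarrow> 3 \<Rightarrow> 3) \<Rightarrow> nat \<Rightarrow> nat \<Rightarrow> 3 \<Rightarrow> 3" where
  "arr_entry \<Sigma> i j = (if i < j then \<Sigma> i j else inv (\<Sigma> j i))"

definition points :: "nat \<Rightarrow> ((3 ^ 'd) \<times> nat) set" where
  "points r = UNIV \<times> {0..r}"

definition rel_R ::
  "nat \<Rightarrow> (nat \<Rightarrow> (3 ^ 'd) \<Rightarrow> 3) \<Rightarrow> (nat \<Rightarrow> nat \<Rightarrow> nat) \<Rightarrow> (nat \<Rightarrow> nat \<Rightarrow> 3 \<Rightarrow> 3) \<Rightarrow>
    (((3 ^ 'd) \<times> nat) \<times> ((3 ^ 'd) \<times> nat)) set" where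
  "rel_R r \<pi> dia \<Sigma> = {((u, i), (v, j)) | u i v j.
     (u, i) \<in> points r \<and> (v, j) \<in> points r \<and> i \<noteq> j \<and>
     arr_entry \<Sigma> i j (\<pi> (dia i j) u) = \<pi> (dia j i) v}"

definition rel_S :: "nat \<Rightarrow> (((3 ^ 'd) \<times> nat) \<times> ((3 ^ 'd) \<times> nat)) set" where
  "rel_S r = {((u, i), (v, j)) | u i v j.
     (u, i) \<in> points r \<and> (v, j) \<in> points r \<and> i = j \<and> u \<noteq> v}"

end

theory Submission
  imports Defs
begin

text \<open>
  All classes are symmetric, so the sums of intersection numbers are entries of the Jordan products
  \<open>CD + DC\<close> of adjacency matrices. Write \<open>n = 3^d\<close>, and count paths from \<open>u\<^sub>i\<close> to \<open>v\<^sub>j\<close> through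
  two classes \<open>R\<^sub>k\<close>, \<open>R\<^sub>l\<close>. If \<open>i \<noteq> j\<close>, every \<open>m \<notin> {i, j}\<close> contributes two affine
  conditions with respect to different hyperplanes, hence \<open>n / 9\<close> midpoints. If \<open>i = j\<close>, every
  \<open>m \<noteq> i\<close> contributes \<open>n / 3\<close> or \<open>0\<close> midpoints. For \<open>k = l\<close> this depends on whether the functional
  \<open>\<pi>\<close> with index \<open>i \<diamond> m\<close> agrees on \<open>u\<close> and \<open>v\<close>; as \<open>m\<close> varies this index runs through all
  hyperplanes, and the number of those containing \<open>u - v \<noteq> 0\<close> is constant. For \<open>k \<noteq> l\<close> the product
  \<open>R\<^sub>k R\<^sub>l\<close> alone is not constant on classes, but a derangement \<open>c\<close> of a 3-element set is a 3-cycle, so for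
  \<open>x \<noteq> y\<close> exactly one of \<open>c x = y\<close> and \<open>c y = x\<close> holds: symmetrising counts the hyperplanes not
  containing \<open>u - v\<close>.
\<close>

subsection \<open>Linear functionals over the field with three elements\<close>

lemma three_cases: "(x::3) = 0 \<or> x = 1 \<or> x = 2"
proof (cases x rule: bit1_cases)
  case (of_int z)
  then have "z = 0 \<or> z = 1 \<or> z = 2" by auto
  then show ?thesis using of_int by auto
qed

lemma cycle_012: "cycle_of_list [0, 1, 2] (x::3) = x + 1"
  using three_cases[of x] by (auto simp: transpose_def)

lemma cycle_021: "cycle_of_list [0, 2, 1] (x::3) = x + 2"
  using three_cases[of x] by (auto simp: transpose_def)

text \<open>Sending the first triple to the second is a derangement of a 3-element set, hence a
  3-cycle. Of two distinct elements, exactly one is then the image of the other.\<close>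

lemma latin_three:
  fixes a b c a' b' c' :: 3
  assumes "a \<noteq> b" "a \<noteq> c" "b \<noteq> c" "a' \<noteq> b'" "a' \<noteq> c'" "b' \<noteq> c'" "a \<noteq> a'" "b \<noteq> b'" "c \<noteq> c'"
  shows "(a = b') \<longleftrightarrow> \<not> (b = a')"
proof -
  have "card {a, b, c} = CARD(3)" using assms(1-3) by simp
  then have "{a, b, c} = UNIV" by (intro card_subset_eq) simp_all
  then have "a' \<in> {a, b, c}" "b' \<in> {a, b, c}" "c' \<in> {a, b, c}" by simp_all
  then show ?thesis using assms by auto
qed

text \<open>Any two fibres are translates of each other: adding some \<open>t\<close> with
  \<open>f t = d - c\<close> carries the fibre over \<open>c\<close> onto the fibre over
  \<open>d\<close>. The domain is thus cut into equal pieces.\<close>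

lemma card_fibre:
  fixes f :: "'v::{finite, ab_group_add} \<Rightarrow> 'w::{finite, ab_group_add}"
  assumes add: "\<And>x y. f (x + y) = f x + f y" and surj: "surj f"
  shows "CARD('v) = CARD('w) * card {x. f x = c}"
proof -
  have eq: "card {x. f x = d} = card {x. f x = c}" for d
  proof -
    obtain t where t: "f t = d - c" using surj by (metis surjD)
    have "bij_betw (\<lambda>x. x + t) {x. f x = c} {x. f x = d}"
    proof (rule bij_betwI[where g = "\<lambda>x. x - t"])
      show "(\<lambda>x. x - t) \<in> {x. f x = d} \<rightarrow> {x. f x = c}"
      proof
        fix x assume "x \<in> {x. f x = d}"
        then have "f (x - t) + f t = d" using add[of "x - t" t] by simp
        then show "x - t \<in> {x. f x = c}" using t by (simp add: algebra_simps)
      qed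
    qed (auto simp: add t)
    then show ?thesis by (metis bij_betw_same_card)
  qed
  have "CARD('v) = card (\<Union>d\<in>UNIV. {x. f x = d})"
    by (rule arg_cong[where f = card]) auto
  also have "\<dots> = (\<Sum>d\<in>UNIV. card {x. f x = d})"
    by (rule card_UN_disjoint) auto
  also have "\<dots> = (\<Sum>d\<in>(UNIV :: 'w set). card {x. f x = c})"
    by (intro sum.cong refl eq)
  finally show ?thesis by simp
qed

lemma card_Collect_prod:
  assumes "finite M"
  shows "card {(w::'w::finite, m). m \<in> M \<and> P w m} = (\<Sum>m\<in>M. card {w. P w m})"
proof -
  have "{(w, m). m \<in> M \<and> P w m} = prod.swap ` (SIGMA m:M. {w. P w m})"
    by force
  moreover have "card (prod.swap ` (SIGMA m:M. {w. P w m})) = card (SIGMA m:M. {w. P w m})"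
    by (intro card_image) (auto intro: inj_onI)
  ultimately show ?thesis using assms by simp
qed

text \<open>Since neither kernel contains the other, there are \<open>p\<close> and
  \<open>q\<close>, each killed by exactly one functional. Their multiples adjust the two values
  independently, so the pair of functionals is onto. The resulting equation also shows that the
  division by 9 is exact.\<close>

lemma card_fibre_pair:
  fixes f g :: "3 ^ 'd \<Rightarrow> 3"
  assumes f: "Vector_Spaces.linear (*s) (*) f" and g: "Vector_Spaces.linear (*s) (*) g"
    and ker: "\<not> {x. f x = 0} \<subseteq> {x. g x = 0}" "\<not> {x. g x = 0} \<subseteq> {x. f x = 0}"
  shows "card {x. f x = c \<and> g x = e} = 3 ^ CARD('d) div 9"
proof -
  interpret f: Vector_Spaces.linear "(*s)" "(*)" f by (rule f)
  interpret g: Vector_Spaces.linear "(*s)" "(*)" g by (rule g)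
  obtain p q where p: "f p = 0" "g p \<noteq> 0" and q: "g q = 0" "f q \<noteq> 0" using ker by auto
  let ?h = "\<lambda>x. (f x, g x)"
  have "surj ?h"
  proof (rule surjI)
    fix z :: "3 \<times> 3"
    show "?h ((fst z / f q) *s q + (snd z / g p) *s p) = z"
      using p q by (auto simp: f.add g.add f.scale g.scale)
  qed
  then have "CARD(3 ^ 'd) = CARD(3 \<times> 3) * card {x. ?h x = (c, e)}"
    by (intro card_fibre) (auto simp: f.add g.add)
  then show ?thesis by simp
qed

lemma card_fibre_linear:
  fixes f :: "3 ^ 'd \<Rightarrow> 3"
  assumes f: "Vector_Spaces.linear (*s) (*) f" and "surj f"
  shows "card {x. f x = c} = 3 ^ CARD('d) div 3"
proof -
  interpret f: Vector_Spaces.linear "(*s)" "(*)" f by (rule f)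
  have "CARD(3 ^ 'd) = CARD(3) * card {x. f x = c}"
    using assms(2) by (intro card_fibre) (auto simp: f.add)
  then show ?thesis by simp
qed

text \<open>Both kernels have a third of all vectors, so an inclusion between them cannot be
  proper.\<close>

lemma kernel_subset_imp_eq:
  fixes f g :: "3 ^ 'd \<Rightarrow> 3"
  assumes f: "Vector_Spaces.linear (*s) (*) f" and g: "Vector_Spaces.linear (*s) (*) g"
    and "surj f" "surj g" and sub: "{x. f x = 0} \<subseteq> {x. g x = 0}"
  shows "{x. f x = 0} = {x. g x = 0}"
proof (rule card_subset_eq[OF _ sub])
  show "card {x. f x = 0} = card {x. g x = 0}"
    using assms by (simp add: card_fibre_linear)
qed simp

lemma linear_eq_sum:
  fixes f :: "3 ^ 'd \<Rightarrow> 3"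
  assumes f: "Vector_Spaces.linear (*s) (*) f"
  shows "f x = (\<Sum>i\<in>UNIV. f (axis i 1) * x $ i)"
proof -
  interpret f: Vector_Spaces.linear "(*s)" "(*)" f by (rule f)
  have "f x = f (\<Sum>i\<in>UNIV. x $ i *s axis i 1)" by (simp add: basis_expansion)
  also have "\<dots> = (\<Sum>i\<in>UNIV. f (axis i 1) * x $ i)"
    by (simp add: f.sum f.scale mult.commute)
  finally show ?thesis .
qed

text \<open>The coefficient vectors of the functionals \<open>\<pi> a\<close> and their negatives are distinct and
  nonzero, so by counting they exhaust the nonzero vectors.\<close>

lemma card_vanishing:
  fixes \<pi> :: "nat \<Rightarrow> 3 ^ 'd \<Rightarrow> 3"
  assumes r: "r = (3 ^ CARD('d) - 1) div 2"
    and lin: "\<And>a. a \<in> {1..r} \<Longrightarrow> Vector_Spaces.linear (*s) (*) (\<pi> a)"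
    and surj: "\<And>a. a \<in> {1..r} \<Longrightarrow> surj (\<pi> a)"
    and inj: "inj_on (\<lambda>a. {x. \<pi> a x = 0}) {1..r}"
    and x: "x \<noteq> 0"
  shows "card {a \<in> {1..r}. \<pi> a x = 0} = (3 ^ CARD('d) div 3 - 1) div 2"
proof -
  define c where "c a = (\<chi> i. \<pi> a (axis i 1))" for a
  define dot where "dot p y = (\<Sum>i\<in>UNIV. p $ i * y $ i)" for p y :: "3 ^ 'd"
  have dot: "\<pi> a y = dot (c a) y" if "a \<in> {1..r}" for a y
    by (subst linear_eq_sum[OF lin[OF that]]) (simp add: dot_def c_def)
  have dot_minus: "dot (- p) y = - dot p y" for p y by (simp add: dot_def sum_negf)
  have c_nz: "c a \<noteq> 0" if "a \<in> {1..r}" for a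
  proof
    assume "c a = 0"
    then have "\<pi> a y = 0" for y using dot[OF that, of y] by (simp add: dot_def)
    then show False using surj[OF that] by (metis surjD zero_neq_one)
  qed
  \<comment> \<open>Vectors that agree up to sign give functionals with the same kernel, and kernels
    determine labels.\<close>
  have c_eq: "a = b" if "a \<in> {1..r}" "b \<in> {1..r}" "c a = c b \<or> c a = - c b" for a b
  proof (rule inj_onD[OF inj])
    show "{x. \<pi> a x = 0} = {x. \<pi> b x = 0}" using that by (auto simp: dot dot_minus)
  qed (use that in auto)
  \<comment> \<open>As 2 is invertible modulo 3, each label contributes two different
    vectors.\<close>
  have nneg: "p \<noteq> - p" if "p \<noteq> 0" for p :: "3 ^ 'd"
  proof
    assume "p = - p"
    have "p $ i = 0" for i
    proof -
      have "p $ i = - (p $ i)" using \<open>p = - p\<close> by (metis vector_uminus_component)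
      then show ?thesis using three_cases[of "p $ i"] by auto
    qed
    then show False using that by (simp add: vec_eq_iff)
  qed
  have inj_c: "inj_on c {1..r}" using c_eq by (auto intro: inj_onI)
  have inj_mc: "inj_on (\<lambda>a. - c a) {1..r}" using c_eq by (auto intro: inj_onI)
  have disj: "c ` A \<inter> (\<lambda>a. - c a) ` A = {}" if "A \<subseteq> {1..r}" for A
  proof (rule ccontr)
    assume "c ` A \<inter> (\<lambda>a. - c a) ` A \<noteq> {}"
    then obtain a b where ab: "a \<in> A" "b \<in> A" "c a = - c b" by auto
    then have "a = b" using c_eq that by blast
    then show False using nneg[OF c_nz, of a] ab that by auto
  qed
  have card_pm: "card (insert 0 (c ` A \<union> (\<lambda>a. - c a) ` A)) = 1 + 2 * card A"
    if "A \<subseteq> {1..r}" for A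
  proof -
    have fin: "finite A" using that finite_subset by blast
    have "card (c ` A \<union> (\<lambda>a. - c a) ` A) = 2 * card A"
      using fin disj[OF that] inj_on_subset[OF inj_c that] inj_on_subset[OF inj_mc that]
      by (simp add: card_Un_disjoint card_image)
    moreover have "0 \<notin> c ` A \<union> (\<lambda>a. - c a) ` A" using c_nz that by force
    ultimately show ?thesis using fin by simp
  qed
  have "2 * r + 1 = 3 ^ CARD('d)"
    using r by simp
  then have "insert 0 (c ` {1..r} \<union> (\<lambda>a. - c a) ` {1..r}) = UNIV"
    using card_pm[of "{1..r}"] by (intro card_subset_eq) simp_all
  then have ex: "p = 0 \<or> (\<exists>a\<in>{1..r}. p = c a \<or> p = - c a)" for p by blast
  define A where "A = {a \<in> {1..r}. \<pi> a x = 0}"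
  \<comment> \<open>The vectors \<open>p\<close> orthogonal to \<open>x\<close> are counted twice:
    by labels there are \<open>1 + 2 * card A\<close> of them, and as the kernel of the functional
    sending \<open>p\<close> to \<open>dot p x\<close> they are a third of the space.\<close>
  have "{p. dot p x = 0} = insert 0 (c ` A \<union> (\<lambda>a. - c a) ` A)"
  proof (intro equalityI subsetI)
    fix p assume p: "p \<in> {p. dot p x = 0}"
    then show "p \<in> insert 0 (c ` A \<union> (\<lambda>a. - c a) ` A)"
      using ex[of p] by (auto simp: A_def dot dot_minus)
  qed (auto simp: A_def dot dot_minus, simp add: dot_def)
  moreover have "A \<subseteq> {1..r}" by (auto simp: A_def)
  ultimately have "card {p. dot p x = 0} = 1 + 2 * card A" using card_pm by metis
  moreover have "card {p. dot p x = 0} = 3 ^ CARD('d) div 3"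
  proof (rule card_fibre_linear)
    show "Vector_Spaces.linear (*s) (*) (\<lambda>p. dot p x)"
      by unfold_locales
        (simp_all add: dot_def algebra_simps sum.distrib sum_distrib_left)
    \<comment> \<open>One nonzero coordinate of \<open>x\<close> already makes this functional
      onto.\<close>
    obtain i where i: "x $ i \<noteq> 0" using x by (auto simp: vec_eq_iff)
    show "surj (\<lambda>p. dot p x)"
    proof (rule surjI)
      fix y
      have "dot (axis i (y / x $ i)) x = (\<Sum>j\<in>UNIV. if j = i then y else 0)"
        unfolding dot_def using i by (intro sum.cong) (auto simp: axis_def)
      then show "dot (axis i (y / x $ i)) x = y" by simp
    qed
  qed
  ultimately show ?thesis by (simp add: A_def)
qed

subsection \<open>Counting paths\<close>

text \<open>An entry of the ordinary product of the adjacency matrices of \<open>C\<close> and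
  \<open>D\<close>; \<open>jordan_count\<close> is its symmetrisation.\<close>

definition paths :: "('a \<times> 'a) set \<Rightarrow> ('a \<times> 'a) set \<Rightarrow> 'a \<Rightarrow> 'a \<Rightarrow> nat" where
  "paths C D \<alpha> \<beta> = card {\<gamma>. (\<alpha>, \<gamma>) \<in> C \<and> (\<gamma>, \<beta>) \<in> D}"

lemma jordan_count_eq_paths: "jordan_count C D \<alpha> \<beta> = paths C D \<alpha> \<beta> + paths D C \<alpha> \<beta>"
  unfolding jordan_count_def paths_def by (intro arg_cong2[where f = "(+)"] arg_cong[where f = card]) auto

lemma jordan_count_commute: "jordan_count C D = jordan_count D C"
  by (intro ext) (simp add: jordan_count_def)

lemma paths_sym: "sym C \<Longrightarrow> sym D \<Longrightarrow> paths C D \<alpha> \<beta> = paths D C \<beta> \<alpha>"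
  unfolding paths_def by (rule arg_cong[where f = card]) (auto dest: symD)

lemma rel_S_iff: "((u, i), (v, j)) \<in> rel_S r \<longleftrightarrow> i = j \<and> i \<le> r \<and> u \<noteq> v"
  by (auto simp: rel_S_def points_def)

lemma rel_R_iff:
  "((u, i), (v, j)) \<in> rel_R r \<pi> dia \<Sigma> \<longleftrightarrow>
     i \<le> r \<and> j \<le> r \<and> i \<noteq> j \<and> arr_entry \<Sigma> i j (\<pi> (dia i j) u) = \<pi> (dia j i) v"
  by (auto simp: rel_R_def points_def)

lemma sym_rel_S: "sym (rel_S r)"
  by (auto simp: sym_def rel_S_iff)

lemma paths_S_S:
  assumes "i \<le> r" "j \<le> r"
  shows "paths (rel_S r) (rel_S r) (u :: 3 ^ 'd, i) (v, j) =
    (if i = j then 3 ^ CARD('d) - (if u = v then 1 else 2) else 0)"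
proof (cases "i = j")
  case False
  then have "{\<gamma>. ((u, i), \<gamma>) \<in> rel_S r \<and> (\<gamma>, (v, j)) \<in> rel_S r} = {}"
    by (auto simp: rel_S_iff)
  then show ?thesis using False by (simp only: paths_def) simp
next
  case True
  \<comment> \<open>The midpoint stays in the copy \<open>i\<close> of the space and avoids
    \<open>u\<close> and \<open>v\<close>, which are one or two points.\<close>
  then have "{\<gamma>. ((u, i), \<gamma>) \<in> rel_S r \<and> (\<gamma>, (v, j)) \<in> rel_S r} = (\<lambda>w. (w, i)) ` (UNIV - {u, v})"
    using assms by (auto simp: rel_S_iff)
  then have "paths (rel_S r) (rel_S r) (u, i) (v, j) = card (UNIV - {u, v})"
    by (simp add: paths_def card_image inj_on_def)
  then show ?thesis using True by (auto simp: card_Diff_subset)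
qed

lemma jordan_count_Id_on:
  assumes "\<alpha> \<in> \<Omega>" "\<beta> \<in> \<Omega>"
  shows "jordan_count (Id_on \<Omega>) C \<alpha> \<beta> = 2 * of_bool ((\<alpha>, \<beta>) \<in> C)"
proof -
  have "{\<gamma>. (\<alpha>, \<gamma>) \<in> Id_on \<Omega> \<and> (\<gamma>, \<beta>) \<in> C} = (if (\<alpha>, \<beta>) \<in> C then {\<alpha>} else {})"
    "{\<gamma>. (\<alpha>, \<gamma>) \<in> C \<and> (\<gamma>, \<beta>) \<in> Id_on \<Omega>} = (if (\<alpha>, \<beta>) \<in> C then {\<beta>} else {})"
    using assms by auto
  then show ?thesis by (simp add: jordan_count_eq_paths paths_def)
qed

text \<open>The counting argument only uses that, for \<open>i \<noteq> j\<close>, the entries of the arrays \<open>\<tau> 0\<close>,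
  \<open>\<tau> 1\<close>, \<open>\<tau> 2\<close> at \<open>(i, j)\<close> are the rows of a Latin square.\<close>

locale latin_arrays =
  fixes r :: nat and \<pi> :: "nat \<Rightarrow> 3 ^ 'd \<Rightarrow> 3" and dia :: "nat \<Rightarrow> nat \<Rightarrow> nat"
    and \<tau> :: "nat \<Rightarrow> nat \<Rightarrow> nat \<Rightarrow> 3 \<Rightarrow> 3" and K1 K2 K3 :: nat
  assumes r_pos: "0 < r"
    and pi_surj: "\<And>a. a \<in> {1..r} \<Longrightarrow> surj (\<pi> a)"
    and fibre: "\<And>a c. a \<in> {1..r} \<Longrightarrow> card {w. \<pi> a w = c} = K1"
    and fibre_pair: "\<And>a b c e. a \<in> {1..r} \<Longrightarrow> b \<in> {1..r} \<Longrightarrow> a \<noteq> b \<Longrightarrow>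
          card {w. \<pi> a w = c \<and> \<pi> b w = e} = K2"
    and agree: "\<And>u v. u \<noteq> v \<Longrightarrow> card {a \<in> {1..r}. \<pi> a u = \<pi> a v} = K3"
    and dia_diag: "\<And>a. a \<in> {0..r} \<Longrightarrow> dia a a = 0"
    and dia_bij: "\<And>a. a \<in> {0..r} \<Longrightarrow> bij_betw (dia a) {0..r} {0..r}"
    and entry_sym: "\<And>k i j x y. k < 3 \<Longrightarrow> i \<le> r \<Longrightarrow> j \<le> r \<Longrightarrow> i \<noteq> j \<Longrightarrow>
          arr_entry (\<tau> k) i j x = y \<longleftrightarrow> arr_entry (\<tau> k) j i y = x"
    and entry_latin: "\<And>i j x y. i \<le> r \<Longrightarrow> j \<le> r \<Longrightarrow> i \<noteq> j \<Longrightarrow>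
          \<exists>!k. k < 3 \<and> arr_entry (\<tau> k) i j x = y"
begin

abbreviation R :: "nat \<Rightarrow> (((3 ^ 'd) \<times> nat) \<times> ((3 ^ 'd) \<times> nat)) set" where
  "R k \<equiv> rel_R r \<pi> dia (\<tau> k)"

abbreviation I :: "(((3 ^ 'd) \<times> nat) \<times> ((3 ^ 'd) \<times> nat)) set" where
  "I \<equiv> Id_on (points r)"

abbreviation S :: "(((3 ^ 'd) \<times> nat) \<times> ((3 ^ 'd) \<times> nat)) set" where
  "S \<equiv> rel_S r"

section \<open>Consequences of the bijectivity and Latin square conditions\<close>

lemma dia_bij_off: "i \<le> r \<Longrightarrow> bij_betw (dia i) ({0..r} - {i}) {1..r}"
proof -
  assume i: "i \<le> r"
  have "bij_betw (dia i) ({0..r} - {i}) ({0..r} - {dia i i})"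
    using dia_bij[of i] dia_diag[of i] i by (intro bij_betw_DiffI) auto
  also have "{0..r} - {dia i i} = {1..r}" using dia_diag[of i] i by auto
  finally show ?thesis .
qed

lemma dia_range: "i \<le> r \<Longrightarrow> j \<le> r \<Longrightarrow> i \<noteq> j \<Longrightarrow> dia i j \<in> {1..r}"
  using bij_betwE[OF dia_bij_off[of i]] by auto

lemma dia_inj: "m \<le> r \<Longrightarrow> i \<le> r \<Longrightarrow> j \<le> r \<Longrightarrow> i \<noteq> j \<Longrightarrow> dia m i \<noteq> dia m j"
  using bij_betw_imp_inj_on[OF dia_bij[of m]] by (auto dest: inj_onD)

lemma entry_inj:
  "k < 3 \<Longrightarrow> i \<le> r \<Longrightarrow> j \<le> r \<Longrightarrow> i \<noteq> j \<Longrightarrow> arr_entry (\<tau> k) i j x = arr_entry (\<tau> k) i j y \<longleftrightarrow> x = y"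
  using entry_sym by metis

lemma entry_neq:
  "k < 3 \<Longrightarrow> l < 3 \<Longrightarrow> k \<noteq> l \<Longrightarrow> i \<le> r \<Longrightarrow> j \<le> r \<Longrightarrow> i \<noteq> j \<Longrightarrow>
     arr_entry (\<tau> k) i j x \<noteq> arr_entry (\<tau> l) i j x"
  using entry_latin by metis

text \<open>The reason why symmetrising works: when \<open>x\<close> and \<open>y\<close> differ,
  exactly one of the two orders of \<open>k\<close> and \<open>l\<close> yields equal
  values.\<close>

lemma entry_cross:
  assumes "k < 3" "l < 3" "k \<noteq> l" "i \<le> r" "j \<le> r" "i \<noteq> j" "x \<noteq> y"
  shows "arr_entry (\<tau> k) i j x = arr_entry (\<tau> l) i j y \<longleftrightarrow>
         \<not> arr_entry (\<tau> l) i j x = arr_entry (\<tau> k) i j y"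
proof -
  \<comment> \<open>The third index completes the values at \<open>x\<close> and at \<open>y\<close>
    to the two triples required by \<open>latin_three\<close>.\<close>
  have "\<exists>m::nat < 3. m \<noteq> k \<and> m \<noteq> l" by presburger
  then obtain m where "m < 3" "m \<noteq> k" "m \<noteq> l" by auto
  with assms show ?thesis
    by (intro latin_three[where c = "arr_entry (\<tau> m) i j x" and c' = "arr_entry (\<tau> m) i j y"])
       (simp_all add: entry_neq entry_inj)
qed

lemma sym_R: "k < 3 \<Longrightarrow> sym (R k)"
  using entry_sym by (auto simp: sym_def rel_R_iff)

lemma R_disjoint: "k < 3 \<Longrightarrow> l < 3 \<Longrightarrow> k \<noteq> l \<Longrightarrow> R k \<inter> R l = {}"
  using entry_neq by (auto simp: rel_R_iff) metis

lemma R_nonempty: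
  assumes "k < 3" shows "R k \<noteq> {}"
proof -
  obtain v where "\<pi> (dia 1 0) v = arr_entry (\<tau> k) 0 1 (\<pi> (dia 0 1) 0)"
    using pi_surj[OF dia_range[of 1 0]] r_pos by (metis One_nat_def Suc_leI le0 surjD zero_neq_one)
  then have "((0, 0), (v, 1)) \<in> R k" using r_pos by (auto simp: rel_R_iff)
  then show ?thesis by auto
qed

lemma R_cover:
  assumes "i \<le> r" "j \<le> r" "i \<noteq> j"
  shows "\<exists>k<3. ((u, i), (v, j)) \<in> R k"
  using ex1_implies_ex[OF entry_latin[OF assms, of "\<pi> (dia i j) u" "\<pi> (dia j i) v"]] assms
  by (auto simp: rel_R_iff)

section \<open>Products of the relations \<open>R k\<close>\<close>

lemma paths_R_R:
  assumes "k < 3" "l < 3" "i \<le> r" "j \<le> r"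
  shows "paths (R k) (R l) (u, i) (v, j) =
    (\<Sum>m\<in>{0..r} - {i, j}. card {w. \<pi> (dia m i) w = arr_entry (\<tau> k) i m (\<pi> (dia i m) u) \<and>
       \<pi> (dia m j) w = arr_entry (\<tau> l) j m (\<pi> (dia j m) v)})"
proof -
  \<comment> \<open>The midpoint is \<open>(w, m)\<close>. Reversing the second edge by
    \<open>entry_sym\<close> turns both edges into prescribed values of functionals at
    \<open>w\<close>.\<close>
  have "{\<gamma>. ((u, i), \<gamma>) \<in> R k \<and> (\<gamma>, (v, j)) \<in> R l} =
    {(w, m). m \<in> {0..r} - {i, j} \<and> \<pi> (dia m i) w = arr_entry (\<tau> k) i m (\<pi> (dia i m) u) \<and>
       \<pi> (dia m j) w = arr_entry (\<tau> l) j m (\<pi> (dia j m) v)}"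
    using assms entry_sym[of l _ j] by (fastforce simp: rel_R_iff)
  then show ?thesis unfolding paths_def by (simp only:, subst card_Collect_prod) simp_all
qed

text \<open>For each \<open>m\<close>, injectivity of \<open>dia m\<close> makes the two conditions
  on the midpoint refer to different hyperplanes, so the count does not depend on the prescribed
  values.\<close>

lemma paths_R_R_off:
  assumes "k < 3" "l < 3" "i \<le> r" "j \<le> r" "i \<noteq> j"
  shows "paths (R k) (R l) (u, i) (v, j) = (r - 1) * K2"
proof -
  have "paths (R k) (R l) (u, i) (v, j) = (\<Sum>m\<in>{0..r} - {i, j}. K2)"
    unfolding paths_R_R[OF assms(1-4)]
  proof (intro sum.cong refl fibre_pair)
    fix m assume "m \<in> {0..r} - {i, j}"
    then show "dia m i \<in> {1..r}" "dia m j \<in> {1..r}" "dia m i \<noteq> dia m j"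
      using assms dia_range[of m i] dia_range[of m j] dia_inj[of m i j] by auto
  qed
  then show ?thesis using assms by (simp add: card_Diff_subset)
qed

lemma jordan_count_R_R_off:
  "k < 3 \<Longrightarrow> l < 3 \<Longrightarrow> i \<le> r \<Longrightarrow> j \<le> r \<Longrightarrow> i \<noteq> j \<Longrightarrow>
     jordan_count (R k) (R l) (u, i) (v, j) = 2 * ((r - 1) * K2)"
  by (simp add: jordan_count_eq_paths paths_R_R_off)

text \<open>Both conditions on the midpoint now prescribe a value of the same functional
  \<open>\<pi> (dia m i)\<close>: they either coincide or contradict each other.\<close>

lemma paths_R_R_diag:
  assumes "k < 3" "l < 3" "i \<le> r"
  shows "paths (R k) (R l) (u, i) (v, i) =
    (\<Sum>m\<in>{0..r} - {i}. K1 * of_bool (arr_entry (\<tau> k) i m (\<pi> (dia i m) u) = arr_entry (\<tau> l) i m (\<pi> (dia i m) v)))"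
  unfolding paths_R_R[OF assms(1,2,3,3)] insert_absorb2
proof (intro sum.cong refl)
  fix m assume m: "m \<in> {0..r} - {i}"
  let ?c = "arr_entry (\<tau> k) i m (\<pi> (dia i m) u)" and ?e = "arr_entry (\<tau> l) i m (\<pi> (dia i m) v)"
  have "card {w. \<pi> (dia m i) w = ?c} = K1"
    using m assms by (intro fibre dia_range) auto
  moreover have "{w. \<pi> (dia m i) w = ?c \<and> \<pi> (dia m i) w = ?e} =
      (if ?c = ?e then {w. \<pi> (dia m i) w = ?c} else {})" by auto
  ultimately show "card {w. \<pi> (dia m i) w = ?c \<and> \<pi> (dia m i) w = ?e} = K1 * of_bool (?c = ?e)"
    by (cases "?c = ?e") simp_all
qed

text \<open>Converts a sum over the copies containing the midpoint into a sum over all hyperplanes,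
  each met once.\<close>

lemma sum_dia:
  assumes "i \<le> r"
  shows "(\<Sum>m\<in>{0..r} - {i}. f (dia i m)) = (\<Sum>a\<in>{1..r}. f a)"
  using sum.reindex_bij_betw[OF dia_bij_off[OF assms]] .

text \<open>With a single array the injective entry cancels, leaving the labels \<open>a\<close> for
  which \<open>\<pi> a\<close> agrees on \<open>u\<close> and \<open>v\<close>.\<close>

lemma paths_R_same_diag:
  assumes "k < 3" "i \<le> r"
  shows "paths (R k) (R k) (u, i) (v, i) = K1 * (if u = v then r else K3)"
proof -
  have "paths (R k) (R k) (u, i) (v, i) =
      (\<Sum>m\<in>{0..r} - {i}. K1 * of_bool (\<pi> (dia i m) u = \<pi> (dia i m) v))"
    unfolding paths_R_R_diag[OF assms(1,1,2)] using assms by (intro sum.cong refl) (simp add: entry_inj)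
  also have "\<dots> = (\<Sum>a\<in>{1..r}. K1 * of_bool (\<pi> a u = \<pi> a v))"
    using assms(2) by (rule sum_dia)
  also have "\<dots> = K1 * card {a \<in> {1..r}. \<pi> a u = \<pi> a v}"
    by (simp add: sum_distrib_left[symmetric] Int_def)
  also have "card {a \<in> {1..r}. \<pi> a u = \<pi> a v} = (if u = v then r else K3)"
    using agree[of u v] by (cases "u = v") (simp_all del: atLeastAtMost_iff)
  finally show ?thesis .
qed

lemma jordan_count_R_same_diag:
  "k < 3 \<Longrightarrow> i \<le> r \<Longrightarrow> jordan_count (R k) (R k) (u, i) (v, i) = 2 * (K1 * (if u = v then r else K3))"
  by (simp add: jordan_count_eq_paths paths_R_same_diag)

text \<open>If \<open>\<pi> (dia i m)\<close> agrees on \<open>u\<close> and \<open>v\<close>,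
  neither order contributes, by \<open>entry_neq\<close>; otherwise exactly one does, by
  \<open>entry_cross\<close>.\<close>

lemma jordan_count_R_R_diag:
  assumes "k < 3" "l < 3" "k \<noteq> l" "i \<le> r"
  shows "jordan_count (R k) (R l) (u, i) (v, i) = K1 * (if u = v then 0 else r - K3)"
proof -
  have "jordan_count (R k) (R l) (u, i) (v, i) =
      (\<Sum>m\<in>{0..r} - {i}. K1 * of_bool (\<pi> (dia i m) u \<noteq> \<pi> (dia i m) v))"
    unfolding jordan_count_eq_paths paths_R_R_diag[OF assms(1,2,4)] paths_R_R_diag[OF assms(2,1,4)]
      sum.distrib[symmetric]
  proof (intro sum.cong refl)
    fix m assume "m \<in> {0..r} - {i}"
    then have m: "m \<le> r" "i \<noteq> m" by auto
    show "K1 * of_bool (arr_entry (\<tau> k) i m (\<pi> (dia i m) u) = arr_entry (\<tau> l) i m (\<pi> (dia i m) v)) +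
        K1 * of_bool (arr_entry (\<tau> l) i m (\<pi> (dia i m) u) = arr_entry (\<tau> k) i m (\<pi> (dia i m) v)) =
        K1 * of_bool (\<pi> (dia i m) u \<noteq> \<pi> (dia i m) v)"
      using entry_neq[OF assms(1-4) m] entry_neq[OF assms(2,1) assms(3)[symmetric] assms(4) m]
        entry_cross[OF assms(1-4) m, of "\<pi> (dia i m) u" "\<pi> (dia i m) v"]
      by (cases "\<pi> (dia i m) u = \<pi> (dia i m) v") auto
  qed
  also have "\<dots> = (\<Sum>a\<in>{1..r}. K1 * of_bool (\<pi> a u \<noteq> \<pi> a v))"
    using assms(4) by (rule sum_dia)
  also have "\<dots> = K1 * card ({1..r} - {a \<in> {1..r}. \<pi> a u = \<pi> a v})"
    by (simp add: sum_distrib_left[symmetric] Int_def set_diff_eq cong: conj_cong)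
  also have "card ({1..r} - {a \<in> {1..r}. \<pi> a u = \<pi> a v}) = (if u = v then 0 else r - K3)"
    using agree[of u v] by (subst card_Diff_subset) (auto simp del: atLeastAtMost_iff)
  finally show ?thesis .
qed

section \<open>Products of \<open>rel_S r\<close> with the relations \<open>R k\<close>\<close>

lemma paths_S_R:
  assumes "k < 3" "i \<le> r" "j \<le> r"
  shows "paths (rel_S r) (R k) (u, i) (v, j) =
    (if i = j then 0 else K1 - of_bool (((u, i), (v, j)) \<in> R k))"
proof (cases "i = j")
  case True
  then have "{\<gamma>. ((u, i), \<gamma>) \<in> rel_S r \<and> (\<gamma>, (v, j)) \<in> R k} = {}"
    by (auto simp: rel_S_iff rel_R_iff)
  then show ?thesis using True by (simp only: paths_def) simp
next
  case False
  let ?W = "{w. \<pi> (dia i j) w = arr_entry (\<tau> k) j i (\<pi> (dia j i) v)}"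
  have iff: "((w, i), (v, j)) \<in> R k \<longleftrightarrow> w \<in> ?W" for w
    using entry_sym[OF assms False, of "\<pi> (dia i j) w" "\<pi> (dia j i) v"] assms False
    by (auto simp: rel_R_iff)
  \<comment> \<open>An \<open>S\<close>-step keeps the copy, so the midpoints form one fibre of
    \<open>\<pi> (dia i j)\<close>, from which \<open>u\<close> is removed if it lies there.\<close>
  have "{\<gamma>. ((u, i), \<gamma>) \<in> rel_S r \<and> (\<gamma>, (v, j)) \<in> R k} = (\<lambda>w. (w, i)) ` (?W - {u})"
    unfolding iff[symmetric] using assms(2) iff by (auto simp: rel_S_iff)
  then have "paths (rel_S r) (R k) (u, i) (v, j) = card (?W - {u})"
    by (simp add: paths_def card_image inj_on_def)
  also have "\<dots> = card ?W - of_bool (u \<in> ?W)" by (simp add: card_Diff_singleton_if)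
  also have "card ?W = K1" using assms False by (intro fibre dia_range) auto
  finally show ?thesis using False by (simp add: iff)
qed

lemma jordan_count_S_R:
  assumes "k < 3" "i \<le> r" "j \<le> r"
  shows "jordan_count (rel_S r) (R k) (u, i) (v, j) =
    2 * (if i = j then 0 else K1 - of_bool (((u, i), (v, j)) \<in> R k))"
  \<comment> \<open>The product in the other order is the same count with the endpoints exchanged,
    and membership in \<open>R k\<close> is unaffected by that exchange.\<close>
  using assms symD[OF sym_R[OF assms(1)]]
  by (auto simp: jordan_count_eq_paths paths_sym[OF sym_R sym_rel_S] paths_S_R)

subsection \<open>The Jordan scheme\<close>

definition classes :: "(((3 ^ 'd) \<times> nat) \<times> ((3 ^ 'd) \<times> nat)) set set" where
  "classes = {I, S, R 0, R 1, R 2}"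

lemma classes_iff:
  "C \<in> classes \<longleftrightarrow> C = I \<or> C = S \<or> (\<exists>k<3. C = R k)"
proof -
  have "(\<exists>k<3. C = R k) \<longleftrightarrow> C = R 0 \<or> C = R 1 \<or> C = R 2"
    by (auto simp: numeral_3_eq_3 less_Suc_eq numeral_2_eq_2)
  then show ?thesis by (auto simp: classes_def)
qed

lemma classes_disjoint:
  assumes "C \<in> classes" "D \<in> classes" "C \<noteq> D"
  shows "C \<inter> D = {}"
proof -
  have IS: "I \<inter> S = {}" by (auto simp: rel_S_iff)
  have IR: "I \<inter> R k = {}" and SR: "S \<inter> R k = {}" for k
    by (auto simp: rel_R_iff rel_S_iff)
  have RR: "R k \<inter> R l = {}" if "R k \<noteq> R l" "k < 3" "l < 3" for k l
    using R_disjoint[OF that(2,3)] that(1) by metis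
  show ?thesis
    using assms IS IR SR RR Int_commute[of C D]
    unfolding classes_iff by (elim disjE exE conjE; hypsubst) metis+
qed

lemma classes_nonempty: "{} \<notin> classes"
proof -
  have "((0, 0), (0, 0)) \<in> I" by (auto simp: points_def)
  then have "I \<noteq> {}" by blast
  moreover have "S \<noteq> {}"
  proof -
    \<comment> \<open>The all-ones vector is nonzero because the index type is nonempty.\<close>
    have "((0 :: 3 ^ 'd, 0), (\<chi> i. 1, 0)) \<in> S" by (simp add: rel_S_iff vec_eq_iff)
    then show ?thesis by blast
  qed
  ultimately show ?thesis using R_nonempty by (auto simp: classes_iff)
qed

lemma Union_classes: "\<Union>classes = points r \<times> points r"
proof
  show "\<Union>classes \<subseteq> points r \<times> points r"
    by (auto simp: classes_def rel_S_iff rel_R_iff points_def)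
  show "points r \<times> points r \<subseteq> \<Union>classes"
  proof
    fix p assume "p \<in> (points r \<times> points r :: (((3 ^ 'd) \<times> nat) \<times> ((3 ^ 'd) \<times> nat)) set)"
    then obtain u v i j where p: "p = ((u, i), (v, j))" "i \<le> r" "j \<le> r"
      by (cases p) (auto simp: points_def)
    consider "i = j" "u = v" | "i = j" "u \<noteq> v" | "i \<noteq> j" by blast
    then have "\<exists>C\<in>classes. p \<in> C"
    proof cases
      case 1
      then show ?thesis using p by (auto simp: classes_def points_def)
    next
      case 2
      then show ?thesis using p by (auto simp: classes_def rel_S_iff)
    next
      case 3
      then obtain k where "k < 3" "p \<in> R k" using R_cover[of i j u v] p by blast
      then show ?thesis using classes_iff by blast
    qed
    then show "p \<in> \<Union>classes" by blast
  qed
qed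

lemma sym_classes: "C \<in> classes \<Longrightarrow> sym C"
  using sym_R sym_rel_S by (auto simp: classes_iff)

lemma rainbow_classes: "rainbow (points r) classes"
  unfolding rainbow_def
proof (intro conjI ballI)
  show "finite (points r :: ((3 ^ 'd) \<times> nat) set)" by (simp add: points_def)
  show "partition_on (points r \<times> points r) classes"
    using classes_disjoint classes_nonempty Union_classes
    by (auto simp: partition_on_def disjoint_def)
  show "\<exists>\<B>\<subseteq>classes. I = \<Union>\<B>"
    by (rule exI[of _ "{I}"]) (auto simp: classes_def)
  show "C\<inverse> \<in> classes" if "C \<in> classes" for C
    using that sym_classes[OF that] by (simp add: sym_conv_converse_eq)
qed

text \<open>Each of the four truth values passed to \<open>f\<close> is constant on every class, so
  this form of the count yields the Jordan condition without comparing numbers.\<close>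

lemma jordan_count_classes:
  assumes "C \<in> classes" "D \<in> classes"
  shows "\<exists>f. \<forall>\<alpha>\<in>points r. \<forall>\<beta>\<in>points r.
    jordan_count C D \<alpha> \<beta> = f (\<alpha> = \<beta>) (snd \<alpha> = snd \<beta>) ((\<alpha>, \<beta>) \<in> C) ((\<alpha>, \<beta>) \<in> D)"
    (is "?P C D")
proof -
  \<comment> \<open>Symmetry in \<open>C\<close> and \<open>D\<close> leaves only the products with
    \<open>I\<close> and those of the types \<open>S S\<close>, \<open>S R\<close> and
    \<open>R R\<close>.\<close>
  have swap: "?P D C" if "?P C D" for C D
  proof -
    from that obtain f where "\<forall>\<alpha>\<in>points r. \<forall>\<beta>\<in>points r.
      jordan_count C D \<alpha> \<beta> = f (\<alpha> = \<beta>) (snd \<alpha> = snd \<beta>) ((\<alpha>, \<beta>) \<in> C) ((\<alpha>, \<beta>) \<in> D)" by blast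
    then show ?thesis
      unfolding jordan_count_commute[of D C] by (intro exI[of _ "\<lambda>a b c d. f a b d c"]) simp
  qed
  have Id: "?P (I) D" for D
    by (rule exI[of _ "\<lambda>_ _ _ d. 2 * of_bool d"]) (simp add: jordan_count_Id_on)
  have SS: "?P (S) (S)"
    by (rule exI[of _ "\<lambda>a b _ _. 2 * (if b then 3 ^ CARD('d) - (if a then 1 else 2) else 0)"])
       (auto simp: points_def jordan_count_eq_paths paths_S_S)
  have SR: "?P (S) (R k)" if "k < 3" for k
    by (rule exI[of _ "\<lambda>_ b _ d. 2 * (if b then 0 else K1 - of_bool d)"])
       (auto simp: points_def jordan_count_S_R that)
  have RR: "?P (R k) (R l)" if kl: "k < 3" "l < 3" for k l
  proof (cases "k = l")
    case True
    show ?thesis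
      by (rule exI[of _ "\<lambda>a b _ _. 2 * (if b then K1 * (if a then r else K3) else (r - 1) * K2)"])
         (auto simp: points_def jordan_count_R_same_diag jordan_count_R_R_off kl True)
  next
    case False
    show ?thesis
      by (rule exI[of _ "\<lambda>a b _ _. if b then K1 * (if a then 0 else r - K3) else 2 * ((r - 1) * K2)"])
         (auto simp: points_def jordan_count_R_R_diag jordan_count_R_R_off kl False)
  qed
  define P where "P C D \<longleftrightarrow> ?P C D" for C D
  have "P I D" "P S S" "k < 3 \<Longrightarrow> P S (R k)" "k < 3 \<Longrightarrow> l < 3 \<Longrightarrow> P (R k) (R l)"
    "P D C \<Longrightarrow> P C D" for C D k l
    unfolding P_def by (fact Id SS SR RR swap)+
  then have "P C D" using assms unfolding classes_iff by metis
  then show ?thesis unfolding P_def .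
qed

lemma jordan_scheme_classes: "jordan_scheme (points r) classes"
  unfolding jordan_scheme_def jordan_configuration_def
proof (intro conjI ballI allI impI rainbow_classes)
  show Id: "I \<in> classes" by (simp add: classes_def)
  have S_mem: "S \<in> classes" by (simp add: classes_def)
  fix C D E and \<alpha> \<beta> \<alpha>' \<beta>'
  assume C: "C \<in> classes" and D: "D \<in> classes" and E: "E \<in> classes"
    and p: "(\<alpha>, \<beta>) \<in> E" and q: "(\<alpha>', \<beta>') \<in> E"
  \<comment> \<open>Classes are disjoint, so for pairs taken from \<open>E\<close> every argument of
    \<open>f\<close> is determined by \<open>E\<close> alone.\<close>
  have mem: "x \<in> F \<longleftrightarrow> F = E" if "F \<in> classes" "x \<in> E" for F x
    using classes_disjoint[OF that(1) E] that by blast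
  have pts: "a \<in> points r \<and> b \<in> points r" if "(a, b) \<in> E" for a b
    using that E Union_classes by blast
  have eq: "a = b \<longleftrightarrow> I = E" if "(a, b) \<in> E" for a b
    using mem[OF Id that] pts[OF that] by auto
  \<comment> \<open>Pairs within one copy of the space make up exactly the classes \<open>I\<close>
    and \<open>S\<close>.\<close>
  have snd_eq: "snd a = snd b \<longleftrightarrow> I = E \<or> S = E" if "(a, b) \<in> E" for a b
    using mem[OF Id that] mem[OF S_mem that] pts[OF that]
    by (cases a; cases b) (auto simp: points_def rel_S_iff)
  obtain f where f: "\<forall>\<alpha>\<in>points r. \<forall>\<beta>\<in>points r.
      jordan_count C D \<alpha> \<beta> = f (\<alpha> = \<beta>) (snd \<alpha> = snd \<beta>) ((\<alpha>, \<beta>) \<in> C) ((\<alpha>, \<beta>) \<in> D)"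
    using jordan_count_classes[OF C D] by blast
  have "jordan_count C D a b = f (I = E) (I = E \<or> S = E) (C = E) (D = E)"
    if "(a, b) \<in> E" for a b
  proof -
    have "jordan_count C D a b = f (a = b) (snd a = snd b) ((a, b) \<in> C) ((a, b) \<in> D)"
      using f pts[OF that] by blast
    then show ?thesis unfolding eq[OF that] snd_eq[OF that] mem[OF C that] mem[OF D that] .
  qed
  then show "jordan_count C D \<alpha> \<beta> = jordan_count C D \<alpha>' \<beta>'" using p q by simp
qed

end

section \<open>Latin squares from powers of 3-cycles\<close>

lemma arr_entry_sym:
  assumes "i < j \<Longrightarrow> bij (\<Sigma> i j)" "j < i \<Longrightarrow> bij (\<Sigma> j i)" "i \<noteq> j"
  shows "arr_entry \<Sigma> i j x = y \<longleftrightarrow> arr_entry \<Sigma> j i y = x"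
  using assms bij_inv_eq_iff[of "\<Sigma> i j" x y] bij_inv_eq_iff[of "\<Sigma> j i" y x]
  by (cases "i < j") (auto simp: arr_entry_def)

text \<open>A 3-cycle is translation by 1 or by 2, so the iterates of \<open>x\<close> with
  exponents 0, 1, 2 are distinct and exhaust the three elements.\<close>

lemma cycle_powers_latin:
  fixes f :: "3 \<Rightarrow> 3"
  assumes "f \<in> {cycle_of_list [0, 1, 2], cycle_of_list [0, 2, 1]}"
  shows "\<exists>!k. k < (3::nat) \<and> (f ^^ k) x = y"
proof -
  have "(\<forall>z. f z = z + 1) \<or> (\<forall>z. f z = z + 2)"
    using assms cycle_012 cycle_021 by blast
  then have d: "x \<noteq> f x" "x \<noteq> f (f x)" "f x \<noteq> f (f x)"
    using three_cases[of x] by auto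
  then have "card {x, f x, f (f x)} = CARD(3)" by simp
  then have "{x, f x, f (f x)} = UNIV" by (intro card_subset_eq) simp_all
  then have y: "y = x \<or> y = f x \<or> y = f (f x)" by blast
  have "k < 3 \<longleftrightarrow> k = 0 \<or> k = 1 \<or> k = 2" for k :: nat by auto
  moreover have "(f ^^ 0) x = x" "(f ^^ 1) x = f x" "(f ^^ 2) x = f (f x)"
    by (simp_all add: numeral_2_eq_2)
  ultimately show ?thesis using d y by metis
qed

lemma bij_cycle:
  fixes f :: "3 \<Rightarrow> 3"
  assumes "f \<in> {cycle_of_list [0, 1, 2], cycle_of_list [0, 2, 1]}"
  shows "bij f"
  using assms permutation_bijective[OF permutation_of_cycle] by blast

theorem theorem4p2:
  fixes r :: nat
    and H :: "nat \<Rightarrow> (3 ^ 'd) set"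
    and \<pi> :: "nat \<Rightarrow> (3 ^ 'd) \<Rightarrow> 3"
    and dia :: "nat \<Rightarrow> nat \<Rightarrow> nat"
    and \<sigma> \<theta> :: "nat \<Rightarrow> nat \<Rightarrow> 3 \<Rightarrow> 3"
  assumes r_eq: "r = (3 ^ CARD('d) - 1) div 2"
    and H_label: "bij_betw H {1..r} hyperplanes"
    and pi_linear: "\<And>i. i \<in> {1..r} \<Longrightarrow> Vector_Spaces.linear (*s) (*) (\<pi> i)"
    and pi_surj: "\<And>i. i \<in> {1..r} \<Longrightarrow> surj (\<pi> i)"
    and pi_ker: "\<And>i. i \<in> {1..r} \<Longrightarrow> {x. \<pi> i x = 0} = H i"
    and dia_diag: "\<And>a. a \<in> {0..r} \<Longrightarrow> dia a a = 0"
    and dia_bij: "\<And>a. a \<in> {0..r} \<Longrightarrow> bij_betw (dia a) {0..r} {0..r}"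
    and sigma_perm: "\<And>i j. i < j \<Longrightarrow> j \<le> r \<Longrightarrow> bij (\<sigma> i j)"
    and theta_cycle: "\<And>i j. i < j \<Longrightarrow> j \<le> r \<Longrightarrow>
          \<theta> i j \<in> {cycle_of_list [0, 1, 2], cycle_of_list [0, 2, 1]}"
  shows "jordan_scheme (points r)
    {Id_on (points r), rel_S r,
     rel_R r \<pi> dia \<sigma>,
     rel_R r \<pi> dia (\<lambda>i j. \<theta> i j \<circ> \<sigma> i j),
     rel_R r \<pi> dia (\<lambda>i j. (\<theta> i j ^^ 2) \<circ> \<sigma> i j)}"
proof -
  \<comment> \<open>One family indexed by the exponent: 0, 1 and 2 give the three arrays of the
    statement.\<close>
  define \<tau> where "\<tau> k i j = (\<theta> i j ^^ k) \<circ> \<sigma> i j" for k i j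
  have H_inj: "inj_on H {1..r}" using H_label by (rule bij_betw_imp_inj_on)
  have ker_inj: "inj_on (\<lambda>a. {x. \<pi> a x = 0}) {1..r}"
    using H_inj inj_on_cong[of "{1..r}" "\<lambda>a. {x. \<pi> a x = 0}" H, OF pi_ker] by blast
  have tau_bij: "bij (\<tau> k i j)" if "i < j" "j \<le> r" for k i j
    unfolding \<tau>_def using bij_cycle[OF theta_cycle[OF that]] sigma_perm[OF that]
    by (intro bij_comp bij_fn)
  have sym: "arr_entry (\<tau> k) i j x = y \<longleftrightarrow> arr_entry (\<tau> k) j i y = x"
    if "i \<le> r" "j \<le> r" "i \<noteq> j" for k i j x y
    using that tau_bij by (intro arr_entry_sym) auto
  have latin_less: "\<exists>!k. k < 3 \<and> arr_entry (\<tau> k) i j x = y" if "i < j" "j \<le> r" for i j x y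
    using cycle_powers_latin[OF theta_cycle[OF that], of "\<sigma> i j x" y] that
    by (simp add: arr_entry_def \<tau>_def)
  \<comment> \<open>The constants are the size of a hyperplane, the size of the intersection of two,
    and the number of hyperplanes through a nonzero vector. In dimension 1 the second is 0, and
    \<open>r = 1\<close> leaves no two labels to compare.\<close>
  interpret latin_arrays r \<pi> dia \<tau> "3 ^ CARD('d) div 3" "3 ^ CARD('d) div 9"
    "(3 ^ CARD('d) div 3 - 1) div 2"
  proof
    have "3 ^ 1 \<le> (3::nat) ^ CARD('d)" by (intro power_increasing) (simp_all add: Suc_leI)
    then show "0 < r" using r_eq by simp
    show "surj (\<pi> a)" if "a \<in> {1..r}" for a using pi_surj that .
    show "card {w. \<pi> a w = c} = 3 ^ CARD('d) div 3" if "a \<in> {1..r}" for a c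
      using card_fibre_linear[OF pi_linear[OF that] pi_surj[OF that]] .
    show "card {w. \<pi> a w = c \<and> \<pi> b w = e} = 3 ^ CARD('d) div 9"
      if ab: "a \<in> {1..r}" "b \<in> {1..r}" "a \<noteq> b" for a b c e
    proof (rule card_fibre_pair[OF pi_linear pi_linear])
      have neq: "{x. \<pi> a x = 0} \<noteq> {x. \<pi> b x = 0}" using inj_onD[OF ker_inj _ ab(1,2)] ab(3) by blast
      \<comment> \<open>Distinct kernels of equal size cannot be nested.\<close>
      show "\<not> {x. \<pi> a x = 0} \<subseteq> {x. \<pi> b x = 0}" "\<not> {x. \<pi> b x = 0} \<subseteq> {x. \<pi> a x = 0}"
        using neq kernel_subset_imp_eq[OF pi_linear[OF ab(1)] pi_linear[OF ab(2)] pi_surj[OF ab(1)] pi_surj[OF ab(2)]]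
          kernel_subset_imp_eq[OF pi_linear[OF ab(2)] pi_linear[OF ab(1)] pi_surj[OF ab(2)] pi_surj[OF ab(1)]]
        by auto
    qed (use ab in auto)
    show "card {a \<in> {1..r}. \<pi> a u = \<pi> a v} = (3 ^ CARD('d) div 3 - 1) div 2" if "u \<noteq> v" for u v
    proof -
      \<comment> \<open>Agreement on \<open>u\<close> and \<open>v\<close> becomes vanishing on the
        nonzero vector \<open>u - v\<close>.\<close>
      have "\<pi> a (u - v) = \<pi> a u - \<pi> a v" if a: "a \<in> {1..r}" for a
      proof -
        interpret f: Vector_Spaces.linear "(*s)" "(*)" "\<pi> a" by (rule pi_linear[OF a])
        show ?thesis by (rule f.diff)
      qed
      then have "{a \<in> {1..r}. \<pi> a u = \<pi> a v} = {a \<in> {1..r}. \<pi> a (u - v) = 0}" by auto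
      then show ?thesis
        using card_vanishing[OF r_eq pi_linear pi_surj ker_inj, of "u - v"] that by simp
    qed
    show "dia a a = 0" if "a \<in> {0..r}" for a using dia_diag that .
    show "bij_betw (dia a) {0..r} {0..r}" if "a \<in> {0..r}" for a using dia_bij that .
    show "arr_entry (\<tau> k) i j x = y \<longleftrightarrow> arr_entry (\<tau> k) j i y = x"
      if "k < 3" "i \<le> r" "j \<le> r" "i \<noteq> j" for k i j x y using sym that by blast
    show "\<exists>!k. k < 3 \<and> arr_entry (\<tau> k) i j x = y" if "i \<le> r" "j \<le> r" "i \<noteq> j" for i j x y
    proof (cases "i < j")
      case True
      then show ?thesis using that(2) by (rule latin_less)
    next
      case False
      \<comment> \<open>Below the diagonal the entries are inverses, so the claim is the one above
        the diagonal with \<open>x\<close> and \<open>y\<close> exchanged.\<close>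
      then have "\<exists>!k. k < 3 \<and> arr_entry (\<tau> k) j i y = x" using that by (intro latin_less) auto
      then show ?thesis unfolding sym[OF that] .
    qed
  qed
  have "\<tau> 0 = \<sigma>" "\<tau> 1 = (\<lambda>i j. \<theta> i j \<circ> \<sigma> i j)" "\<tau> 2 = (\<lambda>i j. (\<theta> i j ^^ 2) \<circ> \<sigma> i j)"
    by (auto simp: \<tau>_def fun_eq_iff)
  then show ?thesis using jordan_scheme_classes unfolding classes_def by simp
qed

end
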